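(* Let $|a|<1$ and $b\in\mathbb R$. Then, for each $i\in\{1,2,3,4\}$, the map $F_i$ has a unique Lipschitz invariant curve. (Here $0<a<1$ for $i=1,2,3$ and $-1<a<0$ for $i=4$, according to the definition of the maps.)
   Context: $\mathbb T=\mathbb R/2\pi\mathbb Z$, $\omega\notin 2\pi\mathbb Q$, and $g:\mathbb T\to\mathbb R$ is of class $C^{1+\tau}$ for some $\tau>0$. For $i=1,2,3,4$, $F_i:\mathbb R\times\mathbb T\to\mathbb R\times\mathbb T$ is $F_i(x,\theta)=(h_i(x)+\sigma_i b\,g(\theta),\ \theta+\omega)$ with $\sigma_1=\sigma_4=-1$, $\sigma_2=\sigma_3=1$, where $a>0$ for $i=1,2,3$, $a<0$ for $i=4$, and - $h_1(x)=-\frac{\pi}{2}$ if $x<-\frac{\pi}{2a}$, $h_1(x)=ax$ if $|x|\le\frac{\pi}{2a}$, $h_1(x)=\frac{\pi}{2}$ if $x>\frac{\pi}{2a}$; - $h_2(x)=a(x+\delta)$ if $x<-\delta$, $h_2(x)=0$ if $|x|\le\delta$, $h_2(x)=a(x-\delta)$ if $x>\delta$ (here $\delta>0$ is fixed); - $h_3(x)=ax$ if $x>-\frac1a$, $h_3(x)=-1$ if $x\le-\frac1a$; - $h_4(x)=ax$ if $x>\frac1a$, $h_4(x)=1$ if $x\le\frac1a$. A curve $\varphi:\mathbb T\to\mathbb R$ is invariant for $F_i$ if $\varphi(\theta)=h_i(\varphi(\theta-\omega))+\sigma_i b\,g(\theta-\omega)$ for all $\theta\in\mathbb T$. *)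

theory Defs
  imports "HOL-Analysis.Analysis"
begin

definition mod_two_pi :: "real \<Rightarrow> real \<Rightarrow> bool" where
  "mod_two_pi x y \<longleftrightarrow> (\<exists>k::int. x - y = 2 * pi * of_int k)"

lemma equivp_mod_two_pi: "equivp mod_two_pi"
proof (rule equivpI)
  show "reflp mod_two_pi"
    unfolding reflp_def mod_two_pi_def by (auto intro!: exI[of _ 0])
  show "symp mod_two_pi"
  proof (rule sympI)
    fix x y assume "mod_two_pi x y"
    then obtain k :: int where "x - y = 2 * pi * of_int k" unfolding mod_two_pi_def by blast
    then have "y - x = 2 * pi * of_int (- k)" by simp
    then show "mod_two_pi y x" unfolding mod_two_pi_def by blast
  qed
  show "transp mod_two_pi"
  proof (rule transpI)
    fix x y z assume "mod_two_pi x y" "mod_two_pi y z"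
    then obtain k l :: int where "x - y = 2 * pi * of_int k" "y - z = 2 * pi * of_int l"
      unfolding mod_two_pi_def by blast
    then have "x - z = 2 * pi * of_int (k + l)" by (simp add: algebra_simps)
    then show "mod_two_pi x z" unfolding mod_two_pi_def by blast
  qed
qed

quotient_type circle = real / mod_two_pi
  by (rule equivp_mod_two_pi)

lift_definition circle_of :: "real \<Rightarrow> circle" is "\<lambda>x. x" .

lemma circle_of_eq_iff: "circle_of x = circle_of y \<longleftrightarrow> (\<exists>k::int. x - y = 2 * pi * of_int k)"
  by transfer (simp add: mod_two_pi_def)

lemma circle_of_surj: "\<exists>x. X = circle_of x"
  by transfer (use equivp_mod_two_pi in \<open>auto intro: equivp_reflp\<close>)

instantiation circle :: ab_group_add
begin

lift_definition zero_circle :: circle is "0" .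

lift_definition plus_circle :: "circle \<Rightarrow> circle \<Rightarrow> circle" is "(+)"
proof -
  fix x x' y y' assume "mod_two_pi x x'" "mod_two_pi y y'"
  then obtain k l :: int where "x - x' = 2 * pi * of_int k" "y - y' = 2 * pi * of_int l"
    unfolding mod_two_pi_def by blast
  then have "(x + y) - (x' + y') = 2 * pi * of_int (k + l)" by (simp add: algebra_simps)
  then show "mod_two_pi (x + y) (x' + y')" unfolding mod_two_pi_def by blast
qed

lift_definition uminus_circle :: "circle \<Rightarrow> circle" is "uminus"
proof -
  fix x x' assume "mod_two_pi x x'"
  then obtain k :: int where "x - x' = 2 * pi * of_int k"
    unfolding mod_two_pi_def by blast
  then have "- x - - x' = 2 * pi * of_int (- k)" by simp
  then show "mod_two_pi (- x) (- x')" unfolding mod_two_pi_def by blast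
qed

definition minus_circle :: "circle \<Rightarrow> circle \<Rightarrow> circle" where
  "minus_circle X Y = X + - Y"

instance
proof
  have r: "mod_two_pi x x" for x by (rule equivp_reflp[OF equivp_mod_two_pi])
  fix X Y Z :: circle
  show "X + Y + Z = X + (Y + Z)" by transfer (simp add: add.assoc r)
  show "X + Y = Y + X" by transfer (simp add: add.commute r)
  show "0 + X = X" by transfer (simp add: r)
  show "- X + X = 0" by transfer (simp add: r)
  show "X - Y = X + - Y" by (rule minus_circle_def)
qed

end

lemma circle_of_add: "circle_of (x + y) = circle_of x + circle_of y"
  by transfer (rule equivp_reflp[OF equivp_mod_two_pi])

lemma circle_of_minus: "circle_of (- x) = - circle_of x"
  by transfer (rule equivp_reflp[OF equivp_mod_two_pi])

lemma circle_of_diff: "circle_of (x - y) = circle_of x - circle_of y"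
  using circle_of_add[of x "- y"] by (simp add: circle_of_minus)

instantiation circle :: metric_space
begin

definition dist_circle :: "circle \<Rightarrow> circle \<Rightarrow> real" where
  "dist_circle X Y = Inf {\<bar>x - y\<bar> | x y. circle_of x = X \<and> circle_of y = Y}"

definition uniformity_circle :: "(circle \<times> circle) filter" where
  "uniformity_circle = (INF e\<in>{0<..}. principal {(X, Y). dist X Y < e})"

definition open_circle :: "circle set \<Rightarrow> bool" where
  "open_circle U = (\<forall>X\<in>U. \<forall>\<^sub>F (X', Y) in uniformity. X' = X \<longrightarrow> Y \<in> U)"

lemma circle_dist_le: "dist (circle_of x) (circle_of y) \<le> \<bar>x - y\<bar>"
  unfolding dist_circle_def by (rule cInf_lower) (auto intro!: bdd_belowI[of _ 0])

lemma circle_dist_attained: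
  "\<exists>x y. circle_of x = X \<and> circle_of y = Y \<and> dist X Y = \<bar>x - y\<bar>"
proof -
  obtain x y where X: "X = circle_of x" and Y: "Y = circle_of y"
    using circle_of_surj by metis
  define t where "t = (x - y) / (2 * pi)"
  define x' where "x' = x - 2 * pi * of_int (round t)"
  have X': "circle_of x' = X" unfolding X circle_of_eq_iff
    by (rule exI[of _ "- round t"]) (simp add: x'_def)
  have "\<bar>x' - y\<bar> \<le> d"
    if "d \<in> {\<bar>u - v\<bar> | u v. circle_of u = X \<and> circle_of v = Y}" for d
  proof -
    from that obtain u v where d: "d = \<bar>u - v\<bar>"
      and u: "circle_of u = circle_of x" and v: "circle_of v = circle_of y"
      unfolding X Y by blast
    obtain k l :: int where k: "u - x = 2 * pi * of_int k" and l: "v - y = 2 * pi * of_int l"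
      using u v unfolding circle_of_eq_iff by blast
    have xy: "x - y = 2 * pi * t" by (simp add: t_def)
    have "u - v = (x - y) - 2 * pi * of_int (l - k)"
      using k l by (simp add: algebra_simps)
    then have "u - v = 2 * pi * (t - of_int (l - k))"
      unfolding xy by (simp only: right_diff_distrib)
    then have d': "d = 2 * pi * \<bar>t - of_int (l - k)\<bar>" by (simp add: d abs_mult)
    have "x' - y = (x - y) - 2 * pi * of_int (round t)" by (simp add: x'_def)
    then have "x' - y = 2 * pi * (t - of_int (round t))"
      unfolding xy by (simp only: right_diff_distrib)
    then have "\<bar>x' - y\<bar> = 2 * pi * \<bar>t - of_int (round t)\<bar>" by (simp add: abs_mult)
    also have "\<dots> \<le> 2 * pi * \<bar>t - of_int (l - k)\<bar>"
      using round_diff_minimal[of t "l - k"] by (intro mult_left_mono) simp_all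
    finally show ?thesis using d' by simp
  qed
  then have "\<bar>x' - y\<bar> \<le> dist X Y"
    unfolding dist_circle_def by (intro cInf_greatest) (use X' Y in blast)+
  moreover have "dist X Y \<le> \<bar>x' - y\<bar>"
    using circle_dist_le[of x' y] X' Y by simp
  ultimately show ?thesis using X' Y by (metis antisym)
qed

instance
proof
  fix X Y Z :: circle
  show "uniformity = (INF e\<in>{0<..}. principal {(X :: circle, Y). dist X Y < e})"
    by (rule uniformity_circle_def)
  show "open U = (\<forall>X\<in>U. \<forall>\<^sub>F (X', Y) in uniformity. X' = X \<longrightarrow> Y \<in> U)" for U :: "circle set"
    by (rule open_circle_def)
  show "dist X Y = 0 \<longleftrightarrow> X = Y"
  proof
    assume "dist X Y = 0"
    then show "X = Y" using circle_dist_attained[of X Y] by auto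
  next
    assume "X = Y"
    moreover obtain x where "X = circle_of x" using circle_of_surj by metis
    ultimately have "dist X Y \<le> 0" using circle_dist_le[of x x] by simp
    moreover have "dist X Y \<ge> 0" using circle_dist_attained[of X Y] by auto
    ultimately show "dist X Y = 0" by simp
  qed
  show "dist X Y \<le> dist X Z + dist Y Z"
  proof -
    obtain x z where 1: "circle_of x = X" "circle_of z = Z" "dist X Z = \<bar>x - z\<bar>"
      using circle_dist_attained by metis
    obtain y z' where 2: "circle_of y = Y" "circle_of z' = Z" "dist Y Z = \<bar>y - z'\<bar>"
      using circle_dist_attained by metis
    have "circle_of (y + (z - z')) = Y"
      using 1 2 by (simp add: circle_of_add circle_of_diff)
    then have "dist X Y \<le> \<bar>x - (y + (z - z'))\<bar>"
      using circle_dist_le[of x "y + (z - z')"] 1 by simp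
    also have "\<dots> \<le> \<bar>x - z\<bar> + \<bar>y - z'\<bar>" by linarith
    finally show ?thesis using 1 2 by simp
  qed
qed

end

text \<open>
  Class \<open>C\<^sup>r\<close> on the circle for real \<open>r \<ge> 0\<close>, read off the \<open>2\<pi>\<close>-periodic lift: with
  \<open>k = \<lfloor>r\<rfloor>\<close>, the lift is \<open>k\<close> times continuously differentiable and its \<open>k\<close>-th derivative is
  Hoelder continuous with exponent \<open>r - k\<close>. For integer \<open>r\<close> the last condition only says that
  the oscillation of the (continuous, periodic) \<open>k\<close>-th derivative is bounded, so the class is the
  usual \<open>C\<^sup>k\<close>. For a periodic function, a Hoelder bound in terms of \<open>\<bar>x - y\<bar>\<close> is the same as
  one in terms of the distance on the circle.
\<close>

definition class_C :: "real \<Rightarrow> (circle \<Rightarrow> real) \<Rightarrow> bool" where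
  "class_C r g \<longleftrightarrow>
     (let f = (\<lambda>x. g (circle_of x)); k = nat \<lfloor>r\<rfloor> in
        (\<forall>j<k. \<forall>x. (deriv ^^ j) f differentiable (at x)) \<and>
        continuous_on UNIV ((deriv ^^ k) f) \<and>
        (\<exists>C. \<forall>x y. \<bar>(deriv ^^ k) f x - (deriv ^^ k) f y\<bar> \<le> C * \<bar>x - y\<bar> powr frac r))"

definition h1 :: "real \<Rightarrow> real \<Rightarrow> real" where
  "h1 a x = (if x < - (pi / (2 * a)) then - (pi / 2)
             else if \<bar>x\<bar> \<le> pi / (2 * a) then a * x
             else pi / 2)"

definition h2 :: "real \<Rightarrow> real \<Rightarrow> real \<Rightarrow> real" where
  "h2 \<delta> a x = (if x < - \<delta> then a * (x + \<delta>)
               else if \<bar>x\<bar> \<le> \<delta> then 0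
               else a * (x - \<delta>))"

definition h3 :: "real \<Rightarrow> real \<Rightarrow> real" where
  "h3 a x = (if x > - (1 / a) then a * x else - 1)"

definition h4 :: "real \<Rightarrow> real \<Rightarrow> real" where
  "h4 a x = (if x > 1 / a then a * x else 1)"

text \<open>In the following, only the indices 1, 2, 3, 4 are meaningful.\<close>

definition h :: "nat \<Rightarrow> real \<Rightarrow> real \<Rightarrow> real \<Rightarrow> real" where
  "h i \<delta> a = (if i = 1 then h1 a else if i = 2 then h2 \<delta> a else if i = 3 then h3 a else h4 a)"

definition \<sigma> :: "nat \<Rightarrow> real" where
  "\<sigma> i = (if i = 1 \<or> i = 4 then - 1 else 1)"

definition F ::
  "nat \<Rightarrow> real \<Rightarrow> real \<Rightarrow> real \<Rightarrow> real \<Rightarrow> (circle \<Rightarrow> real) \<Rightarrow> real \<times> circle \<Rightarrow> real \<times> circle" where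
  "F i \<delta> a b \<omega> g = (\<lambda>(x, \<theta>). (h i \<delta> a x + \<sigma> i * b * g \<theta>, \<theta> + circle_of \<omega>))"

definition invariant_curve ::
  "real \<Rightarrow> (real \<times> circle \<Rightarrow> real \<times> circle) \<Rightarrow> (circle \<Rightarrow> real) \<Rightarrow> bool" where
  "invariant_curve \<omega> G \<phi> \<longleftrightarrow>
     (\<forall>\<theta>. \<phi> \<theta> = fst (G (\<phi> (\<theta> - circle_of \<omega>), \<theta> - circle_of \<omega>)))"

lemma invariant_curve_F_iff:
  "invariant_curve \<omega> (F i \<delta> a b \<omega> g) \<phi> \<longleftrightarrow>
     (\<forall>\<theta>. \<phi> \<theta> = h i \<delta> a (\<phi> (\<theta> - circle_of \<omega>)) + \<sigma> i * b * g (\<theta> - circle_of \<omega>))"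
  by (simp add: invariant_curve_def F_def)

end

theory Submission
  imports Defs
begin

text \<open>
  Each fibre map \<open>h\<close> is \<open>\<bar>a\<bar>\<close>-Lipschitz, and a \<open>C\<^sup>1\<close> function on the circle is Lipschitz, say with
  constant \<open>K\<close>. Hence the graph transform is a contraction of the bounded continuous functions on
  the circle with the supremum metric, and for \<open>L = K / (1 - \<bar>a\<bar>)\<close> it preserves the closed set
  of \<open>L\<close>-Lipschitz functions, since \<open>\<bar>a\<bar> * L + K = L\<close>. So its fixed point is Lipschitz.
\<close>

section \<open>Contracting skew products\<close>

text \<open>Uniform convergence gives pointwise convergence, and the Lipschitz inequality at a fixed
  pair of points survives the limit because \<open>L\<close> does not depend on the index.
  Closedness makes this set complete, as Banach's theorem requires.\<close>

lemma closed_lipschitz_bcontfun: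
  "closed {f :: 'a::metric_space \<Rightarrow>\<^sub>C 'b::metric_space. L-lipschitz_on UNIV (apply_bcontfun f)}"
  unfolding closed_sequential_limits
proof (intro allI impI, elim conjE)
  fix f and l :: "'a \<Rightarrow>\<^sub>C 'b"
  assume f: "\<forall>n. f n \<in> {f :: 'a \<Rightarrow>\<^sub>C 'b. L-lipschitz_on UNIV (apply_bcontfun f)}" and l: "f \<longlonglongrightarrow> l"
  have lim: "(\<lambda>n. f n x) \<longlonglongrightarrow> l x" for x
    using tendsto_uniform_limitI[OF tendsto_bcontfun_uniform_limit[OF l], of x] by simp
  have "dist (l x) (l y) \<le> L * dist x y" for x y
  proof (rule LIMSEQ_le_const2)
    show "(\<lambda>n. dist (f n x) (f n y)) \<longlonglongrightarrow> dist (l x) (l y)"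
      by (intro tendsto_dist lim)
    show "\<exists>N. \<forall>n\<ge>N. dist (f n x) (f n y) \<le> L * dist x y"
      using f by (auto dest: lipschitz_onD)
  qed
  moreover have "0 \<le> L"
    using f by (auto dest: lipschitz_on_nonneg)
  ultimately show "l \<in> {f. L-lipschitz_on UNIV (apply_bcontfun f)}"
    by (auto intro: lipschitz_onI)
qed

text \<open>This brings every Lipschitz candidate for an invariant section, whatever its constant,
  into the space on which the graph transform contracts.\<close>

lemma lipschitz_on_imp_bcontfun:
  assumes "bounded (UNIV :: 'a::metric_space set)" and f: "L-lipschitz_on UNIV (f :: 'a \<Rightarrow> 'b::metric_space)"
  shows "f \<in> bcontfun"
proof -
  obtain x :: 'a and B where B: "\<And>y. dist x y \<le> B"
    using assms(1) unfolding bounded_def by auto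
  have "dist (f x) (f y) \<le> L * B" for y
    using lipschitz_onD[OF f, of x y] mult_left_mono[OF B lipschitz_on_nonneg[OF f], of y] by simp
  then have "bounded (range f)"
    unfolding bounded_def by blast
  then show ?thesis
    using lipschitz_on_continuous_on[OF f] by (simp add: bcontfun_def)
qed

lemma contracting_skew_product_unique_lipschitz_section:
  fixes h :: "'b::{complete_space, real_normed_vector} \<Rightarrow> 'b" and k :: "'a::metric_space \<Rightarrow> 'b"
  assumes bounded: "bounded (UNIV :: 'a set)"
    and h: "c-lipschitz_on UNIV h" and "c < 1"
    and k: "K-lipschitz_on UNIV k"
    and r: "1-lipschitz_on UNIV r"
  shows "\<exists>!\<phi>. (\<exists>L. L-lipschitz_on UNIV \<phi>) \<and> (\<forall>\<theta>. \<phi> \<theta> = h (\<phi> (r \<theta>)) + k (r \<theta>))"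
proof -
  have c: "0 \<le> c"
    using h by (rule lipschitz_on_nonneg)
  have K: "0 \<le> K"
    using k by (rule lipschitz_on_nonneg)
  define T where "T = (\<lambda>\<phi>::'a \<Rightarrow> 'b. \<lambda>\<theta>. h (\<phi> (r \<theta>)) + k (r \<theta>))"
  \<comment> \<open>The graph transform acts on Lipschitz constants by the affine map M -> c * M +
    K.\<close>
  have T_lipschitz: "(c * M + K)-lipschitz_on UNIV (T \<phi>)" if \<phi>: "M-lipschitz_on UNIV \<phi>" for M \<phi>
  proof -
    have \<phi>r: "(M * 1)-lipschitz_on UNIV (\<lambda>\<theta>. \<phi> (r \<theta>))"
      by (rule lipschitz_on_compose2[OF r lipschitz_on_subset[OF \<phi> subset_UNIV]])
    have "(c * (M * 1))-lipschitz_on UNIV (\<lambda>\<theta>. h (\<phi> (r \<theta>)))"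
      by (rule lipschitz_on_compose2[OF \<phi>r lipschitz_on_subset[OF h subset_UNIV]])
    moreover have "(K * 1)-lipschitz_on UNIV (\<lambda>\<theta>. k (r \<theta>))"
      by (rule lipschitz_on_compose2[OF r lipschitz_on_subset[OF k subset_UNIV]])
    ultimately show ?thesis
      unfolding T_def using lipschitz_on_add by fastforce
  qed
  \<comment> \<open>Arbitrary bounded continuous arguments are treated, not only Lipschitz ones:
    uniqueness will use the contraction on the whole space.\<close>
  have T_bcontfun: "T \<phi> \<in> bcontfun" for \<phi> :: "'a \<Rightarrow>\<^sub>C 'b"
  proof -
    note cont = lipschitz_on_continuous_on[OF h] lipschitz_on_continuous_on[OF k]
      lipschitz_on_continuous_on[OF r]
    have "continuous_on UNIV (\<lambda>\<theta>. \<phi> (r \<theta>))"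
      by (rule continuous_on_compose2[OF continuous_on_apply_bcontfun cont(3) subset_UNIV])
    then have "continuous_on UNIV (\<lambda>\<theta>. h (\<phi> (r \<theta>)))"
      by (rule continuous_on_compose2[OF cont(1) _ subset_UNIV])
    moreover have "continuous_on UNIV (\<lambda>\<theta>. k (r \<theta>))"
      by (rule continuous_on_compose2[OF cont(2,3) subset_UNIV])
    ultimately have "continuous_on UNIV (T \<phi>)"
      unfolding T_def by (rule continuous_on_add)
    moreover have "bounded (range (T \<phi>))"
    proof -
      have "bounded (range (apply_bcontfun \<phi>))" by simp
      then obtain x B where B: "\<And>\<theta>. dist x (\<phi> \<theta>) \<le> B"
        unfolding bounded_def by auto
      \<comment> \<open>\<open>h\<close> itself may be unbounded, but being Lipschitz it maps the
        bounded range of \<phi> to a bounded set.\<close>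
      have "dist (h x) (h (\<phi> \<theta>)) \<le> c * B" for \<theta>
        using lipschitz_onD[OF h, of x "\<phi> \<theta>"] mult_left_mono[OF B c, of \<theta>] by simp
      then have "bounded (range (\<lambda>\<theta>. h (\<phi> (r \<theta>))))"
        unfolding bounded_def by blast
      moreover have "bounded (range k)"
        using lipschitz_on_imp_bcontfun[OF bounded k] by (simp add: bcontfun_def)
      then have "bounded (range (\<lambda>\<theta>. k (r \<theta>)))"
        by (rule bounded_subset) auto
      ultimately show ?thesis
        unfolding T_def by (rule bounded_plus_comp)
    qed
    ultimately show ?thesis
      by (simp add: bcontfun_def)
  qed
  define G where "G = (\<lambda>\<phi>::'a \<Rightarrow>\<^sub>C 'b. Bcontfun (T \<phi>))"
  have G: "apply_bcontfun (G \<phi>) = T \<phi>" for \<phi>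
    unfolding G_def by (rule Bcontfun_inverse[OF T_bcontfun])
  have G_contraction: "dist (G \<phi>) (G \<psi>) \<le> c * dist \<phi> \<psi>" for \<phi> \<psi>
  proof (rule dist_bound)
    fix \<theta>
    have "dist (G \<phi> \<theta>) (G \<psi> \<theta>) \<le> c * dist (\<phi> (r \<theta>)) (\<psi> (r \<theta>))"
      using lipschitz_onD[OF h] by (simp add: G T_def)
    also have "\<dots> \<le> c * dist \<phi> \<psi>"
      by (intro mult_left_mono dist_bounded c)
    finally show "dist (G \<phi> \<theta>) (G \<psi> \<theta>) \<le> c * dist \<phi> \<psi>" .
  qed
  \<comment> \<open>The fixed point of M -> c * M + K, so the functions with this Lipschitz constant
    are mapped to themselves.\<close>
  define L where "L = K / (1 - c)"
  have "c * L + K = L"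
    using \<open>c < 1\<close> by (simp add: L_def field_simps)
  have "0 \<le> L"
    using K \<open>c < 1\<close> by (simp add: L_def)
  define S where "S = {\<phi> :: 'a \<Rightarrow>\<^sub>C 'b. L-lipschitz_on UNIV (apply_bcontfun \<phi>)}"
  have "\<exists>!\<phi>\<in>S. G \<phi> = \<phi>"
  proof (rule Banach_fix[OF _ _ c \<open>c < 1\<close>])
    show "complete S"
      unfolding S_def complete_eq_closed by (rule closed_lipschitz_bcontfun)
    have "const_bcontfun 0 \<in> S"
      using \<open>0 \<le> L\<close> by (simp add: S_def lipschitz_on_def)
    then show "S \<noteq> {}"
      by blast
    show "G ` S \<subseteq> S"
      using T_lipschitz[of L] by (auto simp: S_def G \<open>c * L + K = L\<close>)
  qed (rule G_contraction)
  then obtain \<phi> where \<phi>: "\<phi> \<in> S" "G \<phi> = \<phi>"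
    by auto
  \<comment> \<open>The constant \<open>M\<close> may exceed \<open>L\<close>, so \<psi> need not
    lie in \<open>S\<close> and uniqueness within \<open>S\<close> is not enough. Uniqueness of the
    fixed point of \<open>G\<close> among all bounded continuous functions is used instead.\<close>
  have unique: "\<psi> = apply_bcontfun \<phi>"
    if \<psi>: "M-lipschitz_on UNIV \<psi>" "\<forall>\<theta>. \<psi> \<theta> = h (\<psi> (r \<theta>)) + k (r \<theta>)" for M \<psi>
  proof -
    obtain \<psi>' where \<psi>': "\<psi> = apply_bcontfun \<psi>'"
      using bcontfunE[OF lipschitz_on_imp_bcontfun[OF bounded \<psi>(1)]] .
    have "T \<psi> = \<psi>"
      unfolding T_def using \<psi>(2) by (intro ext) (rule sym, rule spec)
    then have "G \<psi>' = \<psi>'"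
      by (intro bcontfun_eqI) (simp add: G \<psi>')
    then have "\<psi>' = \<phi>"
      using banach_fix_type[OF c \<open>c < 1\<close>, of G] G_contraction \<phi>(2) by blast
    then show ?thesis
      by (simp add: \<psi>')
  qed
  show ?thesis
  proof (rule ex1I)
    have eq: "apply_bcontfun \<phi> = T \<phi>"
      using G[of \<phi>] unfolding \<phi>(2) .
    have "\<phi> \<theta> = h (\<phi> (r \<theta>)) + k (r \<theta>)" for \<theta>
      using fun_cong[OF eq, of \<theta>] unfolding T_def .
    moreover have "L-lipschitz_on UNIV \<phi>"
      using \<phi>(1) by (simp add: S_def)
    ultimately show "(\<exists>L. L-lipschitz_on UNIV \<phi>) \<and> (\<forall>\<theta>. \<phi> \<theta> = h (\<phi> (r \<theta>)) + k (r \<theta>))"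
      by (intro conjI exI allI)
  next
    fix \<psi>
    assume "(\<exists>L. L-lipschitz_on UNIV \<psi>) \<and> (\<forall>\<theta>. \<psi> \<theta> = h (\<psi> (r \<theta>)) + k (r \<theta>))"
    then show "\<psi> = apply_bcontfun \<phi>"
      by (elim conjE exE) (rule unique)
  qed
qed

section \<open>The circle\<close>

text \<open>Every point has a representative in [0, 2 pi), hence lies within 2 pi of the class of
  0.\<close>

lemma bounded_circle: "bounded (UNIV :: circle set)"
  unfolding bounded_def
proof (intro exI ballI)
  fix X :: circle
  obtain x where x: "X = circle_of x"
    using circle_of_surj by metis
  define t where "t = x / (2 * pi)"
  have "circle_of (2 * pi * frac t) = X"
    unfolding x circle_of_eq_iff
    by (rule exI[of _ "- \<lfloor>t\<rfloor>"]) (simp add: t_def frac_def field_simps)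
  then have "dist (circle_of 0) X \<le> \<bar>0 - 2 * pi * frac t\<bar>"
    using circle_dist_le[of 0 "2 * pi * frac t"] by simp
  also have "\<dots> \<le> 2 * pi"
    using frac_lt_1[of t] by (simp add: abs_mult)
  finally show "dist (circle_of 0) X \<le> 2 * pi" .
qed

text \<open>Shifting two representatives that realise the distance keeps their difference.\<close>

lemma circle_translation_lipschitz: "1-lipschitz_on UNIV (\<lambda>X::circle. X - A)"
proof (rule lipschitz_onI)
  fix X Y :: circle
  obtain \<alpha> where \<alpha>: "A = circle_of \<alpha>"
    using circle_of_surj by metis
  obtain x y where xy: "circle_of x = X" "circle_of y = Y" "dist X Y = \<bar>x - y\<bar>"
    using circle_dist_attained by metis
  show "dist (X - A) (Y - A) \<le> 1 * dist X Y"
    using circle_dist_le[of "x - \<alpha>" "y - \<alpha>"] xy by (simp add: \<alpha> circle_of_diff)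
qed simp

text \<open>The circle distance is attained by some pair of representatives; the bound for the lift
  at that pair is the required one.\<close>

lemma circle_fun_lipschitz_if_lift:
  assumes "L-lipschitz_on UNIV (\<lambda>x. g (circle_of x))"
  shows "L-lipschitz_on UNIV g"
proof (rule lipschitz_onI)
  fix X Y :: circle
  obtain x y where xy: "circle_of x = X" "circle_of y = Y" "dist X Y = \<bar>x - y\<bar>"
    using circle_dist_attained by metis
  show "dist (g X) (g Y) \<le> L * dist X Y"
    using lipschitz_onD[OF assms, of x y] xy by (simp add: dist_real_def)
qed (rule lipschitz_on_nonneg[OF assms])

lemma class_C_imp_continuously_differentiable_lift:
  assumes "class_C r g" and "1 \<le> r"
  defines "f \<equiv> \<lambda>x. g (circle_of x)"
  shows "f differentiable at x" and "continuous_on UNIV (deriv f)"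
proof -
  define k where "k = nat \<lfloor>r\<rfloor>"
  have "1 \<le> k"
    using \<open>1 \<le> r\<close> by (simp add: k_def le_nat_iff le_floor_iff)
  have diff: "(deriv ^^ j) f differentiable at x" if "j < k" for j x
    using assms that by (simp add: class_C_def Let_def k_def)
  have cont: "continuous_on UNIV ((deriv ^^ k) f)"
    using assms by (simp add: class_C_def Let_def k_def)
  show "f differentiable at x"
    using diff[of 0] \<open>1 \<le> k\<close> by simp
  \<comment> \<open>If \<open>k\<close> is 1, the continuity clause of \<open>class_C\<close> is the
    claim. If \<open>k\<close> is larger, the first derivative is itself differentiable, hence
    continuous.\<close>
  show "continuous_on UNIV (deriv f)"
  proof (cases "k = 1")
    case True
    then show ?thesis
      using cont by simp
  next
    case False
    then have "deriv f differentiable at x" for x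
      using diff[of 1 x] \<open>1 \<le> k\<close> by simp
    then show ?thesis
      by (auto intro!: continuous_at_imp_continuous_on differentiable_imp_continuous_within)
  qed
qed

text \<open>The derivative of the lift is continuous and periodic, so its bound on one compact
  period holds everywhere; the mean value inequality makes the lift Lipschitz.\<close>

lemma class_C_imp_lipschitz:
  assumes "class_C r g" and "1 \<le> r"
  obtains K where "K-lipschitz_on UNIV g"
proof -
  define f where "f = (\<lambda>x. g (circle_of x))"
  have f_diff: "f differentiable at x" for x
    unfolding f_def by (rule class_C_imp_continuously_differentiable_lift[OF assms])
  have f_cont: "continuous_on UNIV (deriv f)"
    unfolding f_def by (rule class_C_imp_continuously_differentiable_lift[OF assms])
  have f_periodic: "f (2 * pi * of_int n + x) = f x" for n :: int and x
  proof -
    have "circle_of (2 * pi * of_int n + x) = circle_of x"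
      unfolding circle_of_eq_iff by auto
    then show ?thesis
      by (simp add: f_def)
  qed
  have deriv_periodic: "deriv f (2 * pi * of_int n + x) = deriv f x" for n :: int and x
  proof -
    \<comment> \<open>Both derivatives are read as derivatives at 0 of translates of
      \<open>f\<close>, and periodicity makes these translates the same function.\<close>
    have "f \<circ> (\<lambda>y. 2 * pi * of_int n + x + y) = f \<circ> (\<lambda>y. x + y)"
      by (rule ext) (simp only: o_def add.assoc f_periodic)
    then show ?thesis
      using deriv_shift_0[of f x] deriv_shift_0[of f "2 * pi * of_int n + x"] by metis
  qed
  have "compact (deriv f ` {0..2 * pi})"
    by (rule compact_continuous_image[OF continuous_on_subset[OF f_cont]]) auto
  then have "bounded (deriv f ` {0..2 * pi})"
    by (rule compact_imp_bounded)
  then obtain K where K: "\<forall>x\<in>{0..2 * pi}. norm (deriv f x) \<le> K"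
    unfolding bounded_iff by auto
  have deriv_bound: "norm (deriv f x) \<le> K" for x
  proof -
    define t where "t = x / (2 * pi)"
    have "x = 2 * pi * of_int \<lfloor>t\<rfloor> + 2 * pi * frac t"
      by (simp add: t_def frac_def field_simps)
    then have "deriv f x = deriv f (2 * pi * frac t)"
      using deriv_periodic[of "\<lfloor>t\<rfloor>" "2 * pi * frac t"] by (rule ssubst)
    moreover have "2 * pi * frac t \<in> {0..2 * pi}"
      using frac_lt_1[of t] by simp
    ultimately show ?thesis
      using K by simp
  qed
  have "K-lipschitz_on UNIV f"
  proof (rule lipschitz_onI)
    fix x y
    have "norm (f x - f y) \<le> K * norm (x - y)"
      using f_diff deriv_bound
      by (intro field_differentiable_bound[of UNIV f "deriv f"])
        (auto intro: DERIV_deriv_iff_real_differentiable[THEN iffD2])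
    then show "dist (f x) (f y) \<le> K * dist x y"
      by (simp add: dist_norm)
    show "0 \<le> K"
      using deriv_bound[of 0] norm_ge_zero order_trans by blast
  qed
  then show ?thesis
    using that circle_fun_lipschitz_if_lift unfolding f_def by blast
qed

section \<open>The fibre maps\<close>

text \<open>Here and for \<open>h3\<close> and \<open>h4\<close>, the piecewise map is a truncation
  of the line a * x. Truncation is nonexpanding, so only the slope matters for the Lipschitz
  constant.\<close>

lemma h1_eq: "0 < a \<Longrightarrow> h1 a x = max (- (pi / 2)) (min (pi / 2) (a * x))"
  using pi_gt_zero by (auto simp: h1_def max_def min_def field_simps abs_le_iff simp del: pi_gt_zero)

text \<open>Soft thresholding followed by scaling. As \<delta> is positive, at most one of the two
  summands is nonzero at any point.\<close>

lemma h2_eq: "0 < \<delta> \<Longrightarrow> h2 \<delta> a x = a * (max 0 (x - \<delta>) + min 0 (x + \<delta>))"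
  by (auto simp: h2_def max_def min_def)

lemma h3_eq: "0 < a \<Longrightarrow> h3 a x = max (- 1) (a * x)"
  by (auto simp: h3_def max_def field_simps)

text \<open>Since \<open>a\<close> is negative, x > 1 / a means a * x < 1, which is why a minimum
  appears.\<close>

lemma h4_eq: "a < 0 \<Longrightarrow> h4 a x = min 1 (a * x)"
  by (auto simp: h4_def min_def field_simps)

lemma h_lipschitz:
  assumes "0 < \<delta>" and "i \<in> {1, 2, 3, 4}"
    and "i \<in> {1, 2, 3} \<Longrightarrow> 0 < a" and "i = 4 \<Longrightarrow> a < 0"
  shows "\<bar>a\<bar>-lipschitz_on UNIV (h i \<delta> a)"
proof (rule lipschitz_onI)
  fix x y
  have lin: "\<bar>a * x - a * y\<bar> = \<bar>a\<bar> * \<bar>x - y\<bar>"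
    by (simp add: abs_mult flip: right_diff_distrib)
  consider "i = 1" "0 < a" | "i = 2" | "i = 3" "0 < a" | "i = 4" "a < 0"
    using assms by auto
  then have "\<bar>h i \<delta> a x - h i \<delta> a y\<bar> \<le> \<bar>a\<bar> * \<bar>x - y\<bar>"
  proof cases
    case 1
    then show ?thesis
      unfolding lin[symmetric] by (simp add: h_def h1_eq)
  next
    case 2
    let ?t = "\<lambda>x. max 0 (x - \<delta>) + min 0 (x + \<delta>)"
    \<comment> \<open>The two ramps have disjoint supports, so their slopes do not add up and the
      constant is 1 rather than 2.\<close>
    have "\<bar>?t x - ?t y\<bar> \<le> \<bar>x - y\<bar>"
      using \<open>0 < \<delta>\<close> by linarith
    then have "\<bar>a\<bar> * \<bar>?t x - ?t y\<bar> \<le> \<bar>a\<bar> * \<bar>x - y\<bar>"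
      by (rule mult_left_mono) simp
    then show ?thesis
      using 2 \<open>0 < \<delta>\<close> by (simp add: h_def h2_eq abs_mult flip: right_diff_distrib)
  next
    case 3
    then show ?thesis
      unfolding lin[symmetric] by (simp add: h_def h3_eq)
  next
    case 4
    then show ?thesis
      unfolding lin[symmetric] by (simp add: h_def h4_eq)
  qed
  then show "dist (h i \<delta> a x) (h i \<delta> a y) \<le> \<bar>a\<bar> * dist x y"
    by (simp add: dist_real_def)
qed simp

theorem theorem3p13:
  fixes a b \<delta> \<omega> \<tau> :: real and g :: "circle \<Rightarrow> real" and i :: nat
  assumes "\<omega> \<notin> (\<lambda>q. 2 * pi * q) ` \<rat>"
    and "\<tau> > 0" and "class_C (1 + \<tau>) g"
    and "\<delta> > 0"
    and "i \<in> {1, 2, 3, 4}"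
    and "\<bar>a\<bar> < 1"
    and "i \<in> {1, 2, 3} \<Longrightarrow> a > 0"
    and "i = 4 \<Longrightarrow> a < 0"
  shows "\<exists>!\<phi>. (\<exists>L. L-lipschitz_on UNIV \<phi>) \<and> invariant_curve \<omega> (F i \<delta> a b \<omega> g) \<phi>"
proof -
  obtain K where "K-lipschitz_on UNIV g"
    using class_C_imp_lipschitz[OF \<open>class_C (1 + \<tau>) g\<close>] \<open>\<tau> > 0\<close> by auto
  then have "(\<bar>\<sigma> i * b\<bar> * K)-lipschitz_on UNIV (\<lambda>\<theta>. \<sigma> i * b * g \<theta>)"
    by (rule lipschitz_on_cmult_real)
  \<comment> \<open>The base map \<open>r\<close> is the backward rotation by \<omega>, and the
    additive term \<open>k\<close> is the scaled forcing.\<close>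
  from contracting_skew_product_unique_lipschitz_section[OF bounded_circle
      h_lipschitz[OF \<open>\<delta> > 0\<close> assms(5,7,8)] \<open>\<bar>a\<bar> < 1\<close> this circle_translation_lipschitz]
  show ?thesis
    unfolding invariant_curve_F_iff .
qed

end
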